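(* For each natural number $n \geq 1$ there exists an increasing, continuous function $\mathcal{I}_n : (1,\infty) \to \left(0, \frac{\omega_n}{2^{n-1}}\right)$, where $\omega_n$ is the volume of the unit $n$-ball, such that the following holds. If $M^n$ is a closed, convex hypersurface in $\mathbb{R}^{n+1}$ with intrinsic metric $d_M$, $\rho > 1$, and $x,y$ are distinct points of $M$ with $\frac{d_M(x,y)}{|y-x|} \geq \rho$, then $$\mathrm{Area}(M) > \mathcal{I}_n(\rho)\, d_M(x,y)^n.$$
   Context: A closed, convex hypersurface $M^n$ in $\mathbb{R}^{n+1}$ is the boundary of a compact convex set with nonempty interior in $\mathbb{R}^{n+1}$; no smoothness is assumed. $\mathrm{Area}(M)$ is the $n$-dimensional Hausdorff measure of $M$. The intrinsic distance $d_M(x,y)$ is the minimal length of a path contained in $M$ connecting $x$ and $y$, and $|y-x|$ is the Euclidean distance. *)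

theory Defs
  imports "HOL-Analysis.Analysis"
begin

definition closed_convex_hypersurface :: "'a::euclidean_space set \<Rightarrow> bool" where
  "closed_convex_hypersurface M \<longleftrightarrow>
     (\<exists>K. compact K \<and> convex K \<and> interior K \<noteq> {} \<and> M = frontier K)"

(* Hausdorff (outer) measure, normalised by the volume of the n-ball of diameter diam U,
   so that on n-dimensional subspaces it agrees with Lebesgue measure.
   Boundedness has to be demanded separately, as diameter is real-valued and
   unspecified on unbounded sets. The case distinction matters only for n = 0, where 0 ^ 0 = 1. *)

definition hausdorff_pre_measure :: "nat \<Rightarrow> real \<Rightarrow> 'a::metric_space set \<Rightarrow> ennreal" where
  "hausdorff_pre_measure n \<delta> A =
     (INF U \<in> {U :: nat \<Rightarrow> 'a set. A \<subseteq> (\<Union>i. U i) \<and> (\<forall>i. bounded (U i) \<and> diameter (U i) \<le> \<delta>)}.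
        \<Sum>i. if U i = {} then 0
            else ennreal (unit_ball_vol (real n) * (diameter (U i) / 2) ^ n))"

definition hausdorff_measure :: "nat \<Rightarrow> 'a::metric_space set \<Rightarrow> ennreal" where
  "hausdorff_measure n A = (SUP \<delta> \<in> {0<..}. hausdorff_pre_measure n \<delta> A)"

definition path_length :: "(real \<Rightarrow> 'a::metric_space) \<Rightarrow> ennreal" where
  "path_length g =
     (SUP (N, t) \<in> {(N :: nat, t :: nat \<Rightarrow> real). mono_on {..N} t \<and> t 0 = 0 \<and> t N = 1}.
        \<Sum>i<N. ennreal (dist (g (t i)) (g (t (Suc i)))))"

(* The infimum of the lengths of all paths in M from x to y, infinite if there is no rectifiable
   one. On a closed convex hypersurface in dimension at least 2 the infimum is finite
   and attained, i.e. it is the minimal length. *)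

definition intrinsic_dist :: "'a::metric_space set \<Rightarrow> 'a \<Rightarrow> 'a \<Rightarrow> ennreal" where
  "intrinsic_dist M x y =
     (INF g \<in> {g. path g \<and> path_image g \<subseteq> M \<and> pathstart g = x \<and> pathfinish g = y}. path_length g)"

end

theory Submission
  imports Defs
begin

text \<open>
  The function \<open>\<I>\<close> in the theorem can be read off from a positive constant \<open>c\<close>, depending on \<open>n\<close>
  only, such that the area is at least \<open>c * (d - L) ^ n\<close>, where \<open>d\<close> is the intrinsic and \<open>L\<close> the Euclidean
  distance of \<open>x\<close> and \<open>y\<close>. Indeed \<open>d - L \<ge> (1 - 1 / \<rho>) * d\<close> if \<open>d / L \<ge> \<rho>\<close>, so that
  \<open>\<I> \<rho> = c / 2 * (1 - 1 / \<rho>) ^ n\<close> works. Write \<open>M = frontier K\<close> with \<open>K\<close> compact and convex.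

  Upper bounds for \<open>d\<close> come from detours. The nearest-point map onto \<open>K\<close> is 1-Lipschitz and sends
  everything outside the interior of \<open>K\<close> to \<open>M\<close>. Hence \<open>d\<close> is at most the length of any path from \<open>x\<close>
  to \<open>y\<close> that avoids the interior, even if the path leaves \<open>M\<close> (\<open>intrinsic_dist_le_detour\<close>).
  With \<open>e = (y - x) / L\<close> and any unit vector \<open>q\<close>, there is a detour that runs from \<open>x\<close> backwards along
  \<open>e\<close> by \<open>h\<close>, up by \<open>h\<close> in direction \<open>q\<close>, forwards past \<open>y\<close>, down, and back to \<open>y\<close>; its length is
  at most \<open>L + 6 * h\<close> (\<open>intrinsic_dist_le_box_detour\<close>). So if \<open>d > L + 6 * h\<close>, then for every \<open>q\<close> the
  interior of \<open>K\<close> meets the left, the right or the upper side of this box.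

  This cannot happen if \<open>K\<close> is flat around \<open>x\<close> in two orthonormal directions \<open>a\<close> and \<open>b\<close>, with \<open>b\<close>
  orthogonal to \<open>e\<close> (\<open>intrinsic_dist_le_if_flat\<close>): let \<open>q\<close> run through the unit circle of the plane
  of \<open>a\<close> and \<open>b\<close>. Flatness excludes the upper side. The directions in which the left side is met form
  an open set, and so do those for the right side; neither set contains two opposite
  directions, by convexity. As the two sets cover the circle, the antipodal map exchanges them;
  so they are nonempty and disjoint, and the circle would be disconnected.

  Therefore \<open>K\<close> extends by at least \<open>h / 4\<close> in one of two directions that are orthogonal to any \<open>k < n\<close>
  vectors chosen before, and greedy choice yields \<open>n + 1\<close> points of \<open>K\<close> spanning
  a nondegenerate \<open>n\<close>-simplex (\<open>triangular_frame_if_far\<close>). The area of \<open>M\<close> is at least that of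
  its orthogonal projection along a suitable direction, which contains such a simplex
  (\<open>hausdorff_measure_frontier_ge\<close>). That an arbitrary cover of a simplex by small sets has a large
  sum of \<open>n\<close>-th powers of diameters follows by induction on \<open>n\<close>, integrating over parallel
  slices (\<open>diameter_power_sum_ge\<close>).
\<close>

section \<open>Detours and the intrinsic distance\<close>

text \<open>
  The function \<open>\<phi>\<close> plays the role of the arc length of the restriction of \<open>g\<close> to an initial
  interval. Bounding \<open>dist\<close> by its increments turns polygonal sums into telescoping sums, and
  makes concatenation and composition with 1-Lipschitz maps easy.
\<close>

definition length_controlled :: "(real \<Rightarrow> 'a::metric_space) \<Rightarrow> real \<Rightarrow> bool" where
  "length_controlled g l \<longleftrightarrow>
     (\<exists>\<phi>. \<phi> 0 = 0 \<and> \<phi> 1 = l \<and> (\<forall>s t. 0 \<le> s \<longrightarrow> s \<le> t \<longrightarrow> t \<le> 1 \<longrightarrow> dist (g s) (g t) \<le> \<phi> t - \<phi> s))"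

lemma path_length_le_if_controlled:
  assumes "length_controlled g l"
  shows "path_length g \<le> ennreal l"
proof -
  obtain \<phi> where \<phi>: "\<phi> 0 = 0" "\<phi> 1 = l"
    and d: "\<And>s t. 0 \<le> s \<Longrightarrow> s \<le> t \<Longrightarrow> t \<le> (1::real) \<Longrightarrow> dist (g s) (g t) \<le> \<phi> t - \<phi> s"
    using assms unfolding length_controlled_def by blast
  have "(\<Sum>i<N. ennreal (dist (g (t i)) (g (t (Suc i))))) \<le> ennreal l"
    if t: "mono_on {..N} t" "t 0 = 0" "t N = 1" for N :: nat and t :: "nat \<Rightarrow> real"
  proof -
    have rng: "0 \<le> t i" "t i \<le> 1" if "i \<le> N" for i
      using t(1)[THEN mono_onD, of 0 i] t(1)[THEN mono_onD, of i N] t(2,3) that by auto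
    have stp: "t i \<le> t (Suc i)" if "i < N" for i
      using t(1)[THEN mono_onD, of i "Suc i"] that by auto
    have le: "dist (g (t i)) (g (t (Suc i))) \<le> \<phi> (t (Suc i)) - \<phi> (t i)" if "i < N" for i
      using d[of "t i" "t (Suc i)"] rng[of i] rng[of "Suc i"] stp[OF that] that by auto
    have "(\<Sum>i<N. ennreal (dist (g (t i)) (g (t (Suc i))))) 
        = ennreal (\<Sum>i<N. dist (g (t i)) (g (t (Suc i))))"
      by (simp add: sum_ennreal)
    also have "\<dots> \<le> ennreal (\<Sum>i<N. \<phi> (t (Suc i)) - \<phi> (t i))"
      by (intro ennreal_leI sum_mono) (use le in auto)
    also have "(\<Sum>i<N. \<phi> (t (Suc i)) - \<phi> (t i)) = \<phi> (t N) - \<phi> (t 0)"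
      by (rule sum_lessThan_telescope)
    finally show ?thesis by (simp add: t \<phi>)
  qed
  then show ?thesis
    unfolding path_length_def by (auto intro!: SUP_least)
qed

lemma length_controlled_linepath: "length_controlled (linepath a b) (dist a b)"
proof -
  have "dist (linepath a b s) (linepath a b t) \<le> t * dist a b - s * dist a b" if "s \<le> t" for s t
  proof -
    have "linepath a b s - linepath a b t = (t - s) *\<^sub>R (a - b)"
      by (simp add: linepath_def algebra_simps)
    then have "dist (linepath a b s) (linepath a b t) = (t - s) * dist a b"
      using that by (simp add: dist_norm)
    then show ?thesis by (simp add: left_diff_distrib)
  qed
  then show ?thesis
    unfolding length_controlled_def by (intro exI[of _ "\<lambda>t. t * dist a b"]) auto
qed

lemma length_controlled_join:
  assumes "length_controlled f k" "length_controlled g l" "pathfinish f = pathstart g"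
  shows "length_controlled (f +++ g) (k + l)"
proof -
  obtain \<phi> where \<phi>: "\<phi> 0 = 0" "\<phi> 1 = k"
    and df: "\<And>s t. 0 \<le> s \<Longrightarrow> s \<le> t \<Longrightarrow> t \<le> (1::real) \<Longrightarrow> dist (f s) (f t) \<le> \<phi> t - \<phi> s"
    using assms unfolding length_controlled_def by blast
  obtain \<psi> where \<psi>: "\<psi> 0 = 0" "\<psi> 1 = l"
    and dg: "\<And>s t. 0 \<le> s \<Longrightarrow> s \<le> t \<Longrightarrow> t \<le> (1::real) \<Longrightarrow> dist (g s) (g t) \<le> \<psi> t - \<psi> s"
    using assms unfolding length_controlled_def by blast
  define \<xi> where "\<xi> t = (if t \<le> 1/2 then \<phi> (2 * t) else k + \<psi> (2 * t - 1))" for t :: real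
  have "dist ((f +++ g) s) ((f +++ g) t) \<le> \<xi> t - \<xi> s" if st: "0 \<le> s" "s \<le> t" "t \<le> 1" for s t
  proof -
    consider "t \<le> 1/2" | "s \<le> 1/2" "1/2 < t" | "1/2 < s" using st by linarith
    then show ?thesis
    proof cases
      case 1
      then show ?thesis using df[of "2 * s" "2 * t"] st by (auto simp: joinpaths_def \<xi>_def)
    next
      case 2
      have "dist (f (2 * s)) (g (2 * t-1)) \<le> dist (f (2 * s)) (f 1) + dist (g 0) (g (2 * t-1))"
        using dist_triangle[of "f (2 * s)" "g (2 * t-1)" "f 1"] assms(3)
        by (simp add: pathfinish_def pathstart_def)
      then show ?thesis using 2 df[of "2 * s" 1] dg[of 0 "2 * t-1"] st \<phi> \<psi>
        by (auto simp: joinpaths_def \<xi>_def)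
    next
      case 3
      then show ?thesis using dg[of "2 * s-1" "2 * t-1"] st by (auto simp: joinpaths_def \<xi>_def)
    qed
  qed
  moreover have "\<xi> 0 = 0" "\<xi> 1 = k + l" using \<phi> \<psi> by (auto simp: \<xi>_def)
  ultimately show ?thesis unfolding length_controlled_def by blast
qed

text \<open>
  The nearest-point map onto \<open>K\<close> does not increase length, fixes the endpoints, and sends points
  outside the interior to the frontier; so it pushes the detour onto the hypersurface.
\<close>

lemma intrinsic_dist_le_detour:
  fixes K :: "'a::euclidean_space set"
  assumes K: "compact K" "convex K" "interior K \<noteq> {}"
    and xy: "x \<in> frontier K" "y \<in> frontier K"
    and g: "path g" "pathstart g = x" "pathfinish g = y" "path_image g \<inter> interior K = {}"
    and len: "length_controlled g l"
  shows "intrinsic_dist (frontier K) x y \<le> ennreal l"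
proof -
  have cl: "closed K" and ne: "K \<noteq> {}"
    using K by (auto simp: compact_imp_closed)
  have inK: "x \<in> K" "y \<in> K" using xy cl frontier_subset_closed by blast+
  let ?c = "closest_point K"
  have ctr: "?c z \<in> frontier K" if "z \<notin> interior K" for z
  proof (cases "z \<in> K")
    case True
    then show ?thesis using that
      by (simp add: closest_point_self frontier_def) (use closure_subset in blast)
  next
    case False
    have "z \<in> affine hull K - rel_interior K"
      using K that by (simp add: affine_hull_nonempty_interior rel_interior_nonempty_interior)
    then have "?c z \<in> rel_frontier K" using closest_point_in_rel_frontier[OF cl ne] by blast
    then show ?thesis using K by (simp add: rel_frontier_nonempty_interior)
  qed
  have "path (?c \<circ> g)"
    by (intro path_continuous_image g continuous_on_closest_point K cl ne)
  moreover have "path_image (?c \<circ> g) \<subseteq> frontier K"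
    using ctr g(4) by (auto simp: path_image_compose)
  moreover have "pathstart (?c \<circ> g) = x" "pathfinish (?c \<circ> g) = y"
    using g inK by (auto simp: pathstart_compose pathfinish_compose closest_point_self)
  ultimately have "intrinsic_dist (frontier K) x y \<le> path_length (?c \<circ> g)"
    unfolding intrinsic_dist_def by (intro INF_lower) auto
  also have "length_controlled (?c \<circ> g) l"
    using len closest_point_lipschitz[OF K(2) cl ne] 
    unfolding length_controlled_def by (metis comp_apply order_trans)
  then have "path_length (?c \<circ> g) \<le> ennreal l" by (rule path_length_le_if_controlled)
  finally show ?thesis .
qed

text \<open>
  If \<open>x - s * e\<close> were interior, then so would be \<open>x\<close>, which lies strictly between it and \<open>y\<close>.
\<close>

lemma beyond_frontier_points:
  fixes K :: "'a::euclidean_space set"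
  assumes "closed K" "convex K" "x \<in> frontier K" "y \<in> K" "0 < L" "y = x + L *\<^sub>R e" "0 \<le> s"
  shows "x - s *\<^sub>R e \<notin> interior K"
proof
  assume i: "x - s *\<^sub>R e \<in> interior K"
  have s: "0 < s" using i assms by (cases "s = 0") (auto simp: frontier_def)
  have "x = y - (L / (L + s)) *\<^sub>R (y - (x - s *\<^sub>R e))"
    using assms s by (simp add: algebra_simps flip: scaleR_add_left) (simp add: field_simps flip: scaleR_add_left)
  also have "\<dots> \<in> interior K"
    using mem_interior_convex_shrink[OF assms(2) i assms(4)] assms(5) s by simp
  finally show False using assms(3) by (simp add: frontier_def)
qed

text \<open>
  The first and the last of the five sides of the box avoid the interior automatically, by
  \<open>beyond_frontier_points\<close>; the other three have lengths \<open>h\<close>, \<open>L + 2 * h\<close> and \<open>h\<close>.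
\<close>

lemma intrinsic_dist_le_box_detour:
  fixes K :: "'a::euclidean_space set"
  assumes K: "compact K" "convex K" "interior K \<noteq> {}"
    and xy: "x \<in> frontier K" "y \<in> frontier K"
    and e: "norm e = 1" "0 < L" "y = x + L *\<^sub>R e"
    and q: "norm q = 1" "0 < h"
    and left: "\<And>t. 0 \<le> t \<Longrightarrow> t \<le> h \<Longrightarrow> x - h *\<^sub>R e + t *\<^sub>R q \<notin> interior K"
    and right: "\<And>t. 0 \<le> t \<Longrightarrow> t \<le> h \<Longrightarrow> y + h *\<^sub>R e + t *\<^sub>R q \<notin> interior K"
    and top: "\<And>s. -h \<le> s \<Longrightarrow> s \<le> L + h \<Longrightarrow> x + s *\<^sub>R e + h *\<^sub>R q \<notin> interior K"
  shows "intrinsic_dist (frontier K) x y \<le> ennreal (L + 6 * h)"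
proof -
  have cl: "closed K" using K by (simp add: compact_imp_closed)
  have inK: "x \<in> K" "y \<in> K" using xy cl frontier_subset_closed by blast+
  let ?x1 = "x - h *\<^sub>R e" and ?x2 = "x - h *\<^sub>R e + h *\<^sub>R q"
  let ?y1 = "y + h *\<^sub>R e" and ?y2 = "y + h *\<^sub>R e + h *\<^sub>R q"
  let ?g = "linepath x ?x1 +++ linepath ?x1 ?x2 +++ linepath ?x2 ?y2 +++ linepath ?y2 ?y1 +++ linepath ?y1 y"
  have 1: "closed_segment x ?x1 \<inter> interior K = {}"
  proof -
    have "x - s *\<^sub>R e \<notin> interior K" if "0 \<le> s" for s
      using beyond_frontier_points[OF cl K(2) xy(1) inK(2) e(2,3) that] .
    from this[of "_ * h"] show ?thesis using q
      by (auto simp: closed_segment_image_interval algebra_simps)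
  qed
  have 5: "closed_segment ?y1 y \<inter> interior K = {}"
  proof -
    have "y - s *\<^sub>R (- e) \<notin> interior K" if "0 \<le> s" for s
      by (rule beyond_frontier_points[OF cl K(2) xy(2) inK(1) e(2) _ that]) (use e in auto)
    then have *: "y + s *\<^sub>R e \<notin> interior K" if "0 \<le> s" for s using that by simp
    have "(1 - u) *\<^sub>R ?y1 + u *\<^sub>R y = y + ((1 - u) * h) *\<^sub>R e" for u
      by (simp add: algebra_simps)
    with *[of "(1 - _) * h"] show ?thesis using q
      by (auto simp: closed_segment_image_interval)
  qed
  have 2: "closed_segment ?x1 ?x2 \<inter> interior K = {}"
  proof -
    have "(1 - u) *\<^sub>R ?x1 + u *\<^sub>R ?x2 = ?x1 + (u * h) *\<^sub>R q" for u
      by (simp add: algebra_simps)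
    with left[of "_ * h"] show ?thesis using q
      by (auto simp: closed_segment_image_interval mult_left_le_one_le)
  qed
  have 4: "closed_segment ?y2 ?y1 \<inter> interior K = {}"
  proof -
    have "(1 - u) *\<^sub>R ?y1 + u *\<^sub>R ?y2 = ?y1 + (u * h) *\<^sub>R q" for u
      by (simp add: algebra_simps)
    with right[of "_ * h"] show ?thesis using q
      by (subst closed_segment_commute) (auto simp: closed_segment_image_interval mult_left_le_one_le)
  qed
  have 3: "closed_segment ?x2 ?y2 \<inter> interior K = {}"
  proof -
    have *: "(1 - u) *\<^sub>R ?x2 + u *\<^sub>R ?y2 = x + (u * (L + 2 * h) - h) *\<^sub>R e + h *\<^sub>R q" for u
      by (simp add: e(3) algebra_simps flip: scaleR_add_left)
    have "(1 - u) *\<^sub>R ?x2 + u *\<^sub>R ?y2 \<notin> interior K" if "0 \<le> u" "u \<le> 1" for u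
      unfolding * 
    proof (rule top)
      show "- h \<le> u * (L + 2 * h) - h" using that q e by simp
      have "u * (L + 2 * h) \<le> L + 2 * h" using that q e by (intro mult_left_le_one_le) auto
      then show "u * (L + 2 * h) - h \<le> L + h" by simp
    qed
    then show ?thesis by (auto simp: closed_segment_image_interval)
  qed
  have "path_image ?g \<inter> interior K = {}"
    using 1 2 3 4 5 by (simp add: path_image_join Int_Un_distrib2)
  moreover have "length_controlled ?g (dist x ?x1 + (dist ?x1 ?x2 + (dist ?x2 ?y2 + (dist ?y2 ?y1 + dist ?y1 y))))"
    by (intro length_controlled_join length_controlled_linepath) auto
  moreover have "dist x ?x1 + (dist ?x1 ?x2 + (dist ?x2 ?y2 + (dist ?y2 ?y1 + dist ?y1 y))) = L + 6 * h"
  proof -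
    have "?x2 - ?y2 = - ((L + 2 * h) *\<^sub>R e)" by (simp add: e(3) algebra_simps flip: scaleR_add_left)
    then have "dist ?x2 ?y2 = L + 2 * h" using e q by (simp only: dist_norm norm_minus_cancel) simp
    then show ?thesis using e(1) q by (simp add: dist_norm)
  qed
  ultimately show ?thesis
    using intrinsic_dist_le_detour[OF K xy, of ?g] by simp
qed


section \<open>Bodies that are flat in two directions\<close>

lemma unit_vector_orthogonal_to_few:
  fixes S :: "'a::euclidean_space set"
  assumes "finite S" "card S < DIM('a)"
  obtains g where "norm g = 1" "\<And>v. v \<in> S \<Longrightarrow> v \<bullet> g = 0"
proof -
  have "dim S < DIM('a)" using dim_le_card'[OF assms(1)] assms(2) by linarith
  then obtain w where w: "w \<noteq> 0" "\<And>y. y \<in> span S \<Longrightarrow> orthogonal w y"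
    using orthogonal_to_subspace_exists by blast
  have "v \<bullet> sgn w = 0" if "v \<in> S" for v
    using w(2)[OF span_base[OF that]] by (simp add: sgn_div_norm orthogonal_def inner_commute)
  then show ?thesis using w(1) by (intro that[of "sgn w"]) (auto simp: norm_sgn)
qed

lemma convex_contains_point_between_opposite:
  assumes "convex S" "c + t *\<^sub>R q \<in> S" "c - r *\<^sub>R q \<in> S" "0 \<le> t" "0 \<le> (r::real)"
  shows "c \<in> S"
proof (cases "t = 0")
  case False
  then have t: "0 < t + r" using assms by simp
  have "(r / (t + r)) *\<^sub>R (c + t *\<^sub>R q) + (t / (t + r)) *\<^sub>R (c - r *\<^sub>R q) \<in> S"
    using assms t by (intro convexD) (auto simp flip: add_divide_distrib)
  also have "(r / (t + r)) *\<^sub>R (c + t *\<^sub>R q) + (t / (t + r)) *\<^sub>R (c - r *\<^sub>R q)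
      = (r / (t + r) + t / (t + r)) *\<^sub>R c"
    by (simp add: algebra_simps)
  also have "r / (t + r) + t / (t + r) = 1" using t by (simp add: add.commute flip: add_divide_distrib)
  finally show ?thesis by simp
qed (use assms in simp)

text \<open>
  A body that is thin in two orthogonal directions can be bypassed. It may still happen that the
  box in one particular direction \<open>q\<close> fails, for instance when \<open>K\<close> is a long needle, slightly
  inclined to the segment from \<open>x\<close> to \<open>y\<close>. The obstructions for all \<open>q\<close> in the plane of \<open>a\<close> and \<open>b\<close>
  cannot coexist, however, since they would disconnect the circle of directions.
\<close>

lemma intrinsic_dist_le_if_flat:
  fixes K :: "'a::euclidean_space set"
  assumes K: "compact K" "convex K" "interior K \<noteq> {}"
    and xy: "x \<in> frontier K" "y \<in> frontier K"
    and e: "norm e = 1" "0 < L" "y = x + L *\<^sub>R e"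
    and h: "0 < h"
    and ab: "norm a = 1" "norm b = 1" "a \<bullet> b = 0" "e \<bullet> b = 0"
    and flat: "\<And>z. z \<in> K \<Longrightarrow> \<bar>(z - x) \<bullet> a\<bar> \<le> h / 4" "\<And>z. z \<in> K \<Longrightarrow> \<bar>(z - x) \<bullet> b\<bar> \<le> h / 4"
  shows "intrinsic_dist (frontier K) x y \<le> ennreal (L + 6 * h)"
proof (rule ccontr)
  assume far: "\<not> ?thesis"
  have cl: "closed K" using K by (simp add: compact_imp_closed)
  have inK: "x \<in> K" "y \<in> K" using xy cl frontier_subset_closed by blast+
  have cint: "convex (interior K)" using K by simp
  have intK: "z \<in> K" if "z \<in> interior K" for z using that interior_subset by blast
  define left where "left q \<longleftrightarrow> (\<exists>t. 0 \<le> t \<and> t \<le> h \<and> x - h *\<^sub>R e + t *\<^sub>R q \<in> interior K)" for q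
  define right where "right q \<longleftrightarrow> (\<exists>t. 0 \<le> t \<and> t \<le> h \<and> y + h *\<^sub>R e + t *\<^sub>R q \<in> interior K)" for q
  define above where "above q \<longleftrightarrow> (\<exists>s. -h \<le> s \<and> s \<le> L + h \<and> x + s *\<^sub>R e + h *\<^sub>R q \<in> interior K)" for q
  have hit: "left q \<or> right q \<or> above q" if "norm q = 1" for q
    using intrinsic_dist_le_box_detour[OF K xy e that h] far
    unfolding left_def right_def above_def by blast
  have xh: "x - h *\<^sub>R e \<notin> interior K"
    using beyond_frontier_points[OF cl K(2) xy(1) inK(2) e(2,3)] h by simp
  have yh: "y + h *\<^sub>R e \<notin> interior K"
    using beyond_frontier_points[OF cl K(2) xy(2) inK(1) e(2), of "-e" h] h e(3) by simp
  have opp_left: "\<not> left (- q)" if "left q" for q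
    using that xh convex_contains_point_between_opposite[OF cint, of "x - h *\<^sub>R e" _ q]
    unfolding left_def by (simp add: scaleR_minus_right) blast
  have opp_right: "\<not> right (- q)" if "right q" for q
    using that yh convex_contains_point_between_opposite[OF cint, of "y + h *\<^sub>R e" _ q]
    unfolding right_def by (simp add: scaleR_minus_right) blast
  have bb: "b \<bullet> b = 1" "a \<bullet> a = 1" "b \<bullet> a = 0" using ab by (simp_all add: norm_eq_1 inner_commute)
  have ntb: "\<not> above (\<sigma> *\<^sub>R b)" if "\<bar>\<sigma>\<bar> = 1" for \<sigma>
  proof
    assume "above (\<sigma> *\<^sub>R b)"
    then obtain s where s: "x + s *\<^sub>R e + h *\<^sub>R \<sigma> *\<^sub>R b \<in> K" using intK unfolding above_def by blast
    have "(x + s *\<^sub>R e + h *\<^sub>R \<sigma> *\<^sub>R b - x) \<bullet> b = h * \<sigma>" by (simp add: inner_add_left ab bb)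
    then show False using flat(2)[OF s] h that by (simp add: abs_mult)
  qed
  let ?\<alpha> = "e \<bullet> a"
  \<comment> \<open>If opposite sides of the boxes for \<open>q\<close> and \<open>-q\<close> are met, then \<open>K\<close> spans the length of the box, so \<open>e\<close> is nearly orthogonal to \<open>a\<close>; this is what excludes the upper side for the other directions.\<close>
  have step: "\<bar>?\<alpha>\<bar> * (L + 2 * h) \<le> h / 2" if lr: "left q" "right (- q)" and qa: "q \<bullet> a = 0" for q
  proof -
    obtain t t' where t: "x - h *\<^sub>R e + t *\<^sub>R q \<in> K" "y + h *\<^sub>R e + t' *\<^sub>R (- q) \<in> K"
      using lr intK unfolding left_def right_def by blast
    have "(x - h *\<^sub>R e + t *\<^sub>R q - x) \<bullet> a = - h * ?\<alpha>"
      "(y + h *\<^sub>R e + t' *\<^sub>R (- q) - x) \<bullet> a = (L + h) * ?\<alpha>"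
      by (simp_all add: e(3) inner_add_left inner_diff_left qa algebra_simps)
    with flat(1)[OF t(1)] flat(1)[OF t(2)] have "\<bar>h * ?\<alpha>\<bar> \<le> h / 4" "\<bar>(L + h) * ?\<alpha>\<bar> \<le> h / 4" by auto
    then have "h * \<bar>?\<alpha>\<bar> + (L + h) * \<bar>?\<alpha>\<bar> \<le> h / 4 + h / 4"
      unfolding abs_mult using h e by (intro add_mono) auto
    then show ?thesis by (simp add: algebra_simps)
  qed
  have \<alpha>: "\<bar>?\<alpha>\<bar> * (L + 2 * h) \<le> h / 2"
  proof -
    have "left b \<or> right b" "left (- b) \<or> right (- b)"
      using hit[of b] hit[of "- b"] ntb[of 1] ntb[of "-1"] ab by auto
    then have "left b \<and> right (- b) \<or> left (- b) \<and> right (- (- b))"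
      using opp_left[of b] opp_right[of b] by auto
    then show ?thesis using step[of b] step[of "- b"] bb by auto
  qed
  define q where "q \<theta> = cos \<theta> *\<^sub>R a + sin \<theta> *\<^sub>R b" for \<theta> :: real
  have q1: "norm (q \<theta>) = 1" for \<theta>
  proof -
    have "q \<theta> \<bullet> q \<theta> = (cos \<theta>)\<^sup>2 + (sin \<theta>)\<^sup>2"
      by (simp add: q_def inner_add_left inner_add_right bb ab power2_eq_square)
    then show ?thesis by (simp add: norm_eq_1)
  qed
  have nt: "\<not> above (q \<theta>)" for \<theta>
  proof
    assume "above (q \<theta>)"
    then obtain s where s: "- h \<le> s" "s \<le> L + h" "x + s *\<^sub>R e + h *\<^sub>R q \<theta> \<in> K"
      using intK unfolding above_def by blast
    have i: "(x + s *\<^sub>R e + h *\<^sub>R q \<theta> - x) \<bullet> a = s * ?\<alpha> + h * cos \<theta>"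
       "(x + s *\<^sub>R e + h *\<^sub>R q \<theta> - x) \<bullet> b = h * sin \<theta>"
      by (simp_all add: q_def inner_add_left ab bb)
    have "\<bar>s * ?\<alpha>\<bar> \<le> (L + 2 * h) * \<bar>?\<alpha>\<bar>"
      unfolding abs_mult by (intro mult_right_mono) (use s e h in auto)
    then have "\<bar>h * cos \<theta>\<bar> \<le> 3 * h / 4" "\<bar>h * sin \<theta>\<bar> \<le> h / 4"
      using flat(1)[OF s(3)] flat(2)[OF s(3)] \<alpha> unfolding i mult.commute[of "L + 2 * h"] by linarith+
    then have "\<bar>cos \<theta>\<bar> \<le> 3 / 4" "\<bar>sin \<theta>\<bar> \<le> 1 / 4" using h by (auto simp: abs_mult field_simps)
    then have "(cos \<theta>)\<^sup>2 \<le> (3/4)\<^sup>2" "(sin \<theta>)\<^sup>2 \<le> (1/4)\<^sup>2"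
      by (simp_all only: abs_le_square_iff[symmetric] abs_numeral abs_divide abs_one)
    then show False using sin_cos_squared_add[of \<theta>] by (simp add: power2_eq_square)
  qed
  have q\<pi>: "q (\<theta> + pi) = - q \<theta>" for \<theta> by (simp add: q_def)
  \<comment> \<open>The circle is parametrised by its universal cover; \<open>\<theta> + pi\<close> is the antipode of \<open>\<theta>\<close>.\<close>
  define A where "A = {\<theta>. left (q \<theta>)}"
  define B where "B = {\<theta>. right (q \<theta>)}"
  have cover: "\<theta> \<in> A \<or> \<theta> \<in> B" for \<theta> using hit[OF q1] nt by (auto simp: A_def B_def)
  have antiA: "\<theta> + pi \<notin> A" if "\<theta> \<in> A" for \<theta> using opp_left that by (auto simp: A_def q\<pi>)
  have antiB: "\<theta> + pi \<notin> B" if "\<theta> \<in> B" for \<theta> using opp_right that by (auto simp: B_def q\<pi>)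
  have opn: "open {\<theta>. c + t *\<^sub>R q \<theta> \<in> interior K}" for c t
  proof -
    have "continuous_on UNIV (\<lambda>\<theta>. c + t *\<^sub>R q \<theta>)" unfolding q_def by (intro continuous_intros)
    from open_vimage[OF open_interior this] show ?thesis by (simp add: vimage_def)
  qed
  have "A = (\<Union>t\<in>{0..h}. {\<theta>. x - h *\<^sub>R e + t *\<^sub>R q \<theta> \<in> interior K})"
    "B = (\<Union>t\<in>{0..h}. {\<theta>. y + h *\<^sub>R e + t *\<^sub>R q \<theta> \<in> interior K})"
    by (auto simp: A_def B_def left_def right_def)
  then have "open A" "open B" using opn by auto
  moreover have "A \<inter> B = {}" using cover antiA antiB by blast
  moreover have "A \<noteq> {}" "B \<noteq> {}" using cover antiA antiB by blast+
  moreover have "A \<union> B = UNIV" using cover by blast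
  ultimately show False using connected_UNIV[where 'a=real] unfolding connected_def
    by (metis Int_UNIV_right top.extremum order_refl)
qed

section \<open>A large simplex in the body\<close>

text \<open>
  The matrix of inner products of the edge vectors \<open>p j - p 0\<close> with the unit vectors \<open>f j\<close> is triangular
  with diagonal entries at least \<open>\<eta>\<close>. This is a quantitative form of affine independence.
\<close>

definition triangular_frame ::
  "real \<Rightarrow> nat \<Rightarrow> (nat \<Rightarrow> 'a::real_inner) \<Rightarrow> (nat \<Rightarrow> 'a) \<Rightarrow> bool" where
  "triangular_frame \<eta> k p f \<longleftrightarrow>
     (\<forall>j\<in>{1..k}. norm (f j) = 1 \<and> \<eta> \<le> (p j - p 0) \<bullet> f j \<and> (\<forall>i<j. (p i - p 0) \<bullet> f j = 0))"

text \<open>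
  The frame is built greedily. As long as \<open>k < n\<close>, the edge vectors found so far and \<open>e\<close> leave room
  for a unit vector \<open>b\<close> orthogonal to all of them, and the edge vectors and \<open>b\<close> leave room for \<open>a\<close>. Since
  \<open>K\<close> is not flat in the directions \<open>a\<close> and \<open>b\<close>, one of them provides the next vector and the next
  vertex.
\<close>

lemma triangular_frame_if_far:
  fixes K :: "'a::euclidean_space set"
  assumes K: "compact K" "convex K" "interior K \<noteq> {}"
    and xy: "x \<in> frontier K" "y \<in> frontier K"
    and e: "norm e = 1" "0 < L" "y = x + L *\<^sub>R e"
    and h: "0 < h"
    and far: "ennreal (L + 6 * h) < intrinsic_dist (frontier K) x y"
    and k: "k < DIM('a)"
  shows "\<exists>p f. p 0 = x \<and> (\<forall>i\<le>k. p i \<in> K) \<and> triangular_frame (h / 4) k p f"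
  using k
proof (induction k)
  case 0
  have "x \<in> K" using xy K compact_imp_closed frontier_subset_closed by blast
  then show ?case by (intro exI[of _ "\<lambda>_. x"]) (auto simp: triangular_frame_def)
next
  case (Suc k)
  then obtain p f where p: "p 0 = x" "\<And>i. i \<le> k \<Longrightarrow> p i \<in> K" and fr: "triangular_frame (h / 4) k p f"
    by fastforce
  let ?S = "(\<lambda>i. p i - x) ` {1..k}"
  have S: "finite ?S" "card ?S \<le> k" using card_image_le[of "{1..k}"] by auto
  have cS: "card (insert v ?S) < DIM('a)" for v using card_insert_le_m1[of "Suc k" ?S v] S Suc.prems by simp
  obtain b where b: "norm b = 1" "\<And>v. v \<in> insert e ?S \<Longrightarrow> v \<bullet> b = 0"
    using unit_vector_orthogonal_to_few[OF _ cS] S by (metis finite_insert)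
  obtain a where a: "norm a = 1" "\<And>v. v \<in> insert b ?S \<Longrightarrow> v \<bullet> a = 0"
    using unit_vector_orthogonal_to_few[OF _ cS] S by (metis finite_insert)
  have "a \<bullet> b = 0" "e \<bullet> b = 0" using a(2)[of b] b(2)[of e] by (simp_all add: inner_commute)
  from intrinsic_dist_le_if_flat[OF K xy e h a(1) b(1) this]
  obtain z where z: "z \<in> K" "h / 4 < \<bar>(z - x) \<bullet> a\<bar> \<or> h / 4 < \<bar>(z - x) \<bullet> b\<bar>"
    using far by (meson not_le)
  have "\<exists>g. norm g = 1 \<and> (\<forall>v\<in>?S. v \<bullet> g = 0) \<and> h / 4 < \<bar>(z - x) \<bullet> g\<bar>"
    using z(2) a b by (meson insertI2)
  then obtain g0 where g0: "norm g0 = 1" "\<forall>v\<in>?S. v \<bullet> g0 = 0" "h / 4 < \<bar>(z - x) \<bullet> g0\<bar>" by blast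
  \<comment> \<open>The sign makes the diagonal entry positive.\<close>
  define g where "g = (if (z - x) \<bullet> g0 \<ge> 0 then g0 else - g0)"
  have g: "norm g = 1" "\<forall>v\<in>?S. v \<bullet> g = 0" "h / 4 \<le> (z - x) \<bullet> g"
    using g0 by (auto simp: g_def)
  define p' f' where "p' = p(Suc k := z)" and "f' = f(Suc k := g)"
  have "(p i - x) \<bullet> g = 0" if "i \<le> k" for i
    using g(2) p(1) that by (cases "i = 0") auto
  then have "triangular_frame (h / 4) (Suc k) p' f'"
    using fr g p(1) unfolding triangular_frame_def p'_def f'_def by (auto simp: le_Suc_eq)
  moreover have "p' 0 = x" "\<forall>i\<le>Suc k. p' i \<in> K" using p z by (auto simp: p'_def le_Suc_eq)
  ultimately show ?case by blast
qed


section \<open>Lower bounds for the Hausdorff measure\<close>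

text \<open>
  Slice \<open>C\<close> by the hyperplanes \<open>(z - p 0) \<bullet> f k = s\<close> for \<open>0 \<le> s \<le> \<eta> / 2\<close>. Each slice contains a copy of the
  face \<open>p 0, \<dots>, p (k - 1)\<close>, shrunk towards \<open>p k\<close> by at most one half, to which the induction hypothesis
  applies. A covering set of diameter \<open>d\<close> is met only for \<open>s\<close> in an interval of length \<open>2 * d\<close>, so that
  integration over \<open>s\<close> turns the sum of \<open>(k - 1)\<close>-st powers into one of \<open>k\<close>-th powers.
\<close>

lemma diameter_power_sum_ge:
  fixes p :: "nat \<Rightarrow> 'a::euclidean_space"
  assumes "triangular_frame \<eta> k p f" "0 \<le> \<eta>"
    and "convex C" "\<And>i. i \<le> k \<Longrightarrow> p i \<in> C"
    and "C \<subseteq> (\<Union>i. U i)" "\<And>i :: nat. bounded (U i)"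
  shows "ennreal (\<eta> ^ k / 2 ^ (k * (k + 1))) \<le> (\<Sum>i. if U i = {} then 0 else ennreal (diameter (U i) ^ k))"
  using assms
proof (induction k arbitrary: p \<eta> C U)
  case 0
  then obtain i where "U i \<noteq> {}" by blast
  then have "1 \<le> (\<Sum>j\<in>{i}. if U j = {} then 0 else ennreal (diameter (U j) ^ 0))" by simp
  also have "\<dots> \<le> (\<Sum>j. if U j = {} then 0 else ennreal (diameter (U j) ^ 0))"
    by (rule sum_le_suminf) auto
  finally show ?case by simp
next
  case (Suc k)
  show ?case
  proof (cases "\<eta> = 0")
    case False
    then have \<eta>: "0 < \<eta>" using Suc.prems by simp
    define F where "F = f (Suc k)"
    define H where "H = (p (Suc k) - p 0) \<bullet> F"
    have F: "norm F = 1" "\<eta> \<le> H" and F0: "\<And>i. i \<le> k \<Longrightarrow> (p i - p 0) \<bullet> F = 0"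
      using Suc.prems(1) by (auto simp: triangular_frame_def F_def H_def)
    define d where "d i = diameter (U i)" for i
    \<comment> \<open>For empty \<open>U i\<close> the value \<open>c i\<close> is arbitrary, which is harmless: as \<open>d i = 0\<close>, the interval around it is a null set.\<close>
    define c where "c i = ((SOME w. w \<in> U i) - p 0) \<bullet> F" for i
    have d0: "0 \<le> d i" for i using Suc.prems(6) by (simp add: d_def diameter_ge_0)
    have two: "ennreal (2 * r) = 2 * ennreal r" if "0 \<le> r" for r
      using that by (simp add: ennreal_mult)
    let ?m = "ennreal ((\<eta> / 2) ^ k / 2 ^ (k * (k + 1)))"
    have slice: "?m \<le> (\<Sum>i. ennreal (d i ^ k) * indicator {c i - d i..c i + d i} s)"
      if s: "0 \<le> s" "s \<le> \<eta> / 2" for s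
    proof -
      define \<tau> where "\<tau> = s / H"
      have \<tau>: "0 \<le> \<tau>" "\<tau> \<le> 1 / 2" "\<tau> * H = s" using s F \<eta> by (auto simp: \<tau>_def field_simps)
      define p' where "p' i = (1 - \<tau>) *\<^sub>R p i + \<tau> *\<^sub>R p (Suc k)" for i
      define P where "P = {z. (z - p 0) \<bullet> F = s}"
      have p'd: "p' i - p' 0 = (1 - \<tau>) *\<^sub>R (p i - p 0)" for i by (simp add: p'_def algebra_simps)
      have fr: "triangular_frame (\<eta> / 2) k p' f"
        unfolding triangular_frame_def
      proof (intro ballI conjI allI impI)
        fix j assume j: "j \<in> {1..k}"
        then have fj: "norm (f j) = 1" "\<eta> \<le> (p j - p 0) \<bullet> f j" "\<And>i. i < j \<Longrightarrow> (p i - p 0) \<bullet> f j = 0"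
          using Suc.prems(1) by (auto simp: triangular_frame_def)
        show "norm (f j) = 1" by fact
        have "1 / 2 * \<eta> \<le> (1 - \<tau>) * ((p j - p 0) \<bullet> f j)"
          using \<tau> fj \<eta> by (intro mult_mono) auto
        then show "\<eta> / 2 \<le> (p' j - p' 0) \<bullet> f j" by (simp add: p'd)
        show "(p' i - p' 0) \<bullet> f j = 0" if "i < j" for i using fj(3)[OF that] by (simp add: p'd)
      qed
      have p'P: "p' i \<in> P" if "i \<le> k" for i
      proof -
        have "p' i - p 0 = (1 - \<tau>) *\<^sub>R (p i - p 0) + \<tau> *\<^sub>R (p (Suc k) - p 0)"
          by (simp add: p'_def algebra_simps)
        then have "(p' i - p 0) \<bullet> F = (1 - \<tau>) * ((p i - p 0) \<bullet> F) + \<tau> * H"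
          by (simp only: inner_add_left inner_scaleR_left H_def)
        then show ?thesis using F0[OF that] \<tau> by (simp add: P_def)
      qed
      have cP: "convex P"
      proof -
        have "P = {z. F \<bullet> z = s + p 0 \<bullet> F}" by (auto simp: P_def algebra_simps inner_commute)
        then show ?thesis by (simp add: convex_hyperplane)
      qed
      have "?m \<le> (\<Sum>i. if U i \<inter> P = {} then 0 else ennreal (diameter (U i \<inter> P) ^ k))"
      proof (rule Suc.IH[OF fr, of "C \<inter> P"])
        show "convex (C \<inter> P)" using Suc.prems(3) cP by (rule convex_Int)
        show "p' i \<in> C \<inter> P" if "i \<le> k" for i
        proof
          show "p' i \<in> C" unfolding p'_def
            using Suc.prems(3,4) \<tau> that by (intro convexD) auto
        qed (rule p'P[OF that])
        show "bounded (U i \<inter> P)" for i using Suc.prems(6) by (simp add: bounded_Int)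
      qed (use Suc.prems \<eta> in auto)
      also have "\<dots> \<le> (\<Sum>i. ennreal (d i ^ k) * indicator {c i - d i..c i + d i} s)"
      proof (rule suminf_le)
        fix i
        show "(if U i \<inter> P = {} then 0 else ennreal (diameter (U i \<inter> P) ^ k))
            \<le> ennreal (d i ^ k) * indicator {c i - d i..c i + d i} s"
        proof (cases "U i \<inter> P = {}")
          case False
          then obtain z where z: "z \<in> U i" "(z - p 0) \<bullet> F = s" by (auto simp: P_def)
          define w where "w = (SOME w. w \<in> U i)"
          have w: "w \<in> U i" unfolding w_def using z(1) by (rule someI)
          have "\<bar>s - c i\<bar> = \<bar>(z - w) \<bullet> F\<bar>"
            using z(2) by (simp add: c_def w_def algebra_simps)
          also have "\<dots> \<le> norm (z - w)" using Cauchy_Schwarz_ineq2[of "z - w" F] F by simp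
          also have "\<dots> \<le> d i"
            using diameter_bounded_bound[OF Suc.prems(6) z(1) w] by (simp add: d_def dist_norm)
          finally have "s \<in> {c i - d i..c i + d i}" by auto
          moreover have "diameter (U i \<inter> P) \<le> d i" unfolding d_def
            by (intro diameter_subset Suc.prems(6)) auto
          moreover have "0 \<le> diameter (U i \<inter> P)"
            using Suc.prems(6) by (intro diameter_ge_0) (simp add: bounded_Int)
          ultimately show ?thesis using False by (simp add: ennreal_leI power_mono)
        qed simp
      qed auto
      finally show ?thesis .
    qed
    have "?m * ennreal (\<eta> / 2) = (\<integral>\<^sup>+s. ?m * indicator {0..\<eta> / 2} s \<partial>lborel)"
      using \<eta> by (simp add: nn_integral_cmult_indicator)
    also have "\<dots> \<le> (\<integral>\<^sup>+s. (\<Sum>i. ennreal (d i ^ k) * indicator {c i - d i..c i + d i} s) \<partial>lborel)"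
      using slice by (intro nn_integral_mono) (auto simp: indicator_def)
    also have "\<dots> = (\<Sum>i. \<integral>\<^sup>+s. ennreal (d i ^ k) * indicator {c i - d i..c i + d i} s \<partial>lborel)"
      by (rule nn_integral_suminf) auto
    also have "\<dots> = (\<Sum>i. 2 * (if U i = {} then 0 else ennreal (diameter (U i) ^ Suc k)))"
    proof (rule suminf_cong)
      fix i
      have "(\<integral>\<^sup>+s. ennreal (d i ^ k) * indicator {c i - d i..c i + d i} s \<partial>lborel)
          = ennreal (d i ^ k) * ennreal (2 * d i)"
        using d0[of i] by (simp add: nn_integral_cmult_indicator)
      also have "\<dots> = 2 * ennreal (d i ^ Suc k)"
        using d0[of i] by (simp add: mult.left_commute flip: ennreal_mult two)
      also have "\<dots> = 2 * (if U i = {} then 0 else ennreal (diameter (U i) ^ Suc k))"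
        by (simp add: d_def diameter_def)
      finally show "(\<integral>\<^sup>+s. ennreal (d i ^ k) * indicator {c i - d i..c i + d i} s \<partial>lborel) = \<dots>" .
    qed
    also have "\<dots> = 2 * (\<Sum>i. if U i = {} then 0 else ennreal (diameter (U i) ^ Suc k))"
      by (rule ennreal_suminf_cmult)
    finally have main: "?m * ennreal (\<eta> / 2) \<le> 2 * (\<Sum>i. if U i = {} then 0 else ennreal (diameter (U i) ^ Suc k))" .
    have "\<eta> ^ Suc k / 2 ^ (Suc k * (Suc k + 1)) \<le> \<eta> ^ Suc k / 2 ^ (k * (k + 1) + k + 2)"
      using \<eta> by (intro divide_left_mono power_increasing) auto
    also have "2 * \<dots> = (\<eta> / 2) ^ k / 2 ^ (k * (k + 1)) * (\<eta> / 2)"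
      by (simp add: power_add power_divide mult_ac)
    finally have "ennreal (2 * (\<eta> ^ Suc k / 2 ^ (Suc k * (Suc k + 1)))) \<le> ?m * ennreal (\<eta> / 2)"
      using \<eta> by (simp add: ennreal_leI flip: ennreal_mult)
    with main have "2 * ennreal (\<eta> ^ Suc k / 2 ^ (Suc k * (Suc k + 1)))
        \<le> 2 * (\<Sum>i. if U i = {} then 0 else ennreal (diameter (U i) ^ Suc k))"
      using \<eta> by (subst (asm) two) (auto intro: order_trans)
    then show ?thesis by (subst (asm) ennreal_mult_le_mult_iff) auto
  qed simp
qed

text \<open>
  Project along a direction \<open>g\<close> orthogonal to \<open>f 1, \<dots>, f n\<close>. Every line in direction \<open>g\<close> that meets \<open>K\<close> also
  meets the frontier, so both have the same projection, which still carries the frame. The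
  projection does not increase the diameters of covering sets.
\<close>

lemma hausdorff_measure_frontier_ge:
  fixes K :: "'a::euclidean_space set"
  assumes K: "compact K" "convex K"
    and fr: "triangular_frame \<eta> n p f" "0 \<le> \<eta>" "\<And>i. i \<le> n \<Longrightarrow> p i \<in> K"
    and n: "n < DIM('a)"
  shows "ennreal (unit_ball_vol (real n) / 2 ^ n * (\<eta> ^ n / 2 ^ (n * (n + 1)))) \<le> hausdorff_measure n (frontier K)"
proof -
  have "card (f ` {1..n}) < DIM('a)" using card_image_le[of "{1..n}" f] n by auto
  then obtain g where g: "norm g = 1" "\<And>j. j \<in> {1..n} \<Longrightarrow> f j \<bullet> g = 0"
    using unit_vector_orthogonal_to_few[of "f ` {1..n}"] by (metis finite_imageI finite_atLeastAtMost imageI)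
  have gg: "g \<bullet> g = 1" using g(1) by (simp add: norm_eq_1)
  define \<pi> where "\<pi> z = z - (z \<bullet> g) *\<^sub>R g" for z
  have lin: "linear \<pi>" unfolding \<pi>_def by (intro linearI) (auto simp: algebra_simps)
  have contr: "norm (\<pi> z) \<le> norm z" for z
  proof -
    have "(norm (\<pi> z))\<^sup>2 = (norm z)\<^sup>2 - (z \<bullet> g)\<^sup>2"
      unfolding \<pi>_def power2_norm_eq_inner
      by (simp only: inner_diff_left inner_diff_right inner_scaleR_left inner_scaleR_right gg)
        (simp add: inner_commute power2_eq_square)
    also have "\<dots> \<le> (norm z)\<^sup>2" by simp
    finally show ?thesis by (simp add: power2_le_iff_abs_le)
  qed
  have \<pi>f: "\<pi> z \<bullet> f j = z \<bullet> f j" if "j \<in> {1..n}" for z j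
    using g(2)[OF that] by (simp add: \<pi>_def inner_diff_left inner_commute[of g])
  have \<pi>fd: "(\<pi> z - \<pi> w) \<bullet> f j = (z - w) \<bullet> f j" if "j \<in> {1..n}" for z w j
    using that by (simp add: \<pi>f inner_diff_left)
  have frp: "triangular_frame \<eta> n (\<lambda>i. \<pi> (p i)) f"
    using fr(1) unfolding triangular_frame_def by (simp add: \<pi>fd)
  have onto: "\<pi> ` K \<subseteq> \<pi> ` frontier K"
  proof (intro subsetI, elim imageE)
    fix z w assume z: "z \<in> K" "w = \<pi> z"
    show "w \<in> \<pi> ` frontier K"
    proof (cases "z \<in> interior K")
      case True
      obtain t where "z + t *\<^sub>R g \<in> frontier K"
        using ray_to_frontier[OF compact_imp_bounded[OF K(1)] True, of g] g(1) by fastforce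
      moreover have "\<pi> (z + t *\<^sub>R g) = \<pi> z"
        by (simp add: \<pi>_def inner_add_left gg algebra_simps)
      ultimately show ?thesis using z by (metis imageI)
    next
      case False
      then show ?thesis using z closure_subset by (auto simp: frontier_def)
    qed
  qed
  have "ennreal (unit_ball_vol (real n) / 2 ^ n * (\<eta> ^ n / 2 ^ (n * (n + 1))))
      \<le> (\<Sum>i. if U i = {} then 0 else ennreal (unit_ball_vol (real n) * (diameter (U i) / 2) ^ n))"
    if U: "frontier K \<subseteq> (\<Union>i. U i)" "\<And>i :: nat. bounded (U i)" for U
  proof -
    have bp: "bounded (\<pi> ` U i)" for i
      using bounded_linear_image[OF U(2)] lin by (simp add: linear_conv_bounded_linear)
    have "ennreal (\<eta> ^ n / 2 ^ (n * (n + 1))) \<le> (\<Sum>i. if \<pi> ` U i = {} then 0 else ennreal (diameter (\<pi> ` U i) ^ n))"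
    proof (rule diameter_power_sum_ge[OF frp fr(2), of "\<pi> ` K"])
      show "convex (\<pi> ` K)" using lin K(2) by (rule convex_linear_image)
      show "\<pi> ` K \<subseteq> (\<Union>i. \<pi> ` U i)" using onto U(1) by blast
    qed (use fr(3) bp in auto)
    also have "\<dots> \<le> (\<Sum>i. if U i = {} then 0 else ennreal (diameter (U i) ^ n))"
    proof (rule suminf_le)
      fix i
      have "diameter (\<pi> ` U i) \<le> diameter (U i)"
      proof (rule diameter_le)
        show "\<pi> ` U i \<noteq> {} \<or> 0 \<le> diameter (U i)" using U(2) by (simp add: diameter_ge_0)
        fix v w assume "v \<in> \<pi> ` U i" "w \<in> \<pi> ` U i"
        then obtain a b where ab: "a \<in> U i" "b \<in> U i" "v = \<pi> a" "w = \<pi> b" by blast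
        then have "norm (v - w) \<le> norm (a - b)" using contr[of "a - b"] by (simp add: linear_diff[OF lin])
        then show "norm (v - w) \<le> diameter (U i)"
          using diameter_bounded_bound[OF U(2) ab(1,2)] by (simp add: dist_norm)
      qed
      then show "(if \<pi> ` U i = {} then 0 else ennreal (diameter (\<pi> ` U i) ^ n))
         \<le> (if U i = {} then 0 else ennreal (diameter (U i) ^ n))"
        using bp by (auto intro!: ennreal_leI power_mono diameter_ge_0)
    qed auto
    finally have "ennreal (unit_ball_vol (real n) / 2 ^ n) * ennreal (\<eta> ^ n / 2 ^ (n * (n + 1)))
      \<le> ennreal (unit_ball_vol (real n) / 2 ^ n) * (\<Sum>i. if U i = {} then 0 else ennreal (diameter (U i) ^ n))"
      by (rule mult_left_mono) simp
    also have "\<dots> = (\<Sum>i. ennreal (unit_ball_vol (real n) / 2 ^ n) * (if U i = {} then 0 else ennreal (diameter (U i) ^ n)))"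
      by (rule ennreal_suminf_cmult[symmetric])
    also have "\<dots> = (\<Sum>i. if U i = {} then 0 else ennreal (unit_ball_vol (real n) * (diameter (U i) / 2) ^ n))"
      using U(2) by (intro suminf_cong)
        (simp add: diameter_ge_0 unit_ball_vol_nonneg power_divide flip: ennreal_mult)
    finally show ?thesis using fr(2) by (subst ennreal_mult) (auto simp: unit_ball_vol_nonneg)
  qed
  then have "ennreal (unit_ball_vol (real n) / 2 ^ n * (\<eta> ^ n / 2 ^ (n * (n + 1)))) \<le> hausdorff_pre_measure n 1 (frontier K)"
    unfolding hausdorff_pre_measure_def by (intro INF_greatest) auto
  also have "\<dots> \<le> hausdorff_measure n (frontier K)"
    unfolding hausdorff_measure_def by (intro SUP_upper) simp
  finally show ?thesis .
qed

section \<open>The isoperimetric inequality\<close>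

text \<open>
  On a large enough scale \<open>h\<close> every bounded set is flat in all directions.
\<close>

lemma intrinsic_dist_finite:
  fixes K :: "'a::euclidean_space set"
  assumes K: "compact K" "convex K" "interior K \<noteq> {}"
    and xy: "x \<in> frontier K" "y \<in> frontier K"
    and e: "norm e = 1" "0 < L" "y = x + L *\<^sub>R e" and dim: "2 \<le> DIM('a)"
  shows "intrinsic_dist (frontier K) x y < top"
proof -
  obtain b where b: "norm b = 1" "e \<bullet> b = 0"
    using unit_vector_orthogonal_to_few[of "{e}"] dim by auto
  obtain a where a: "norm a = 1" "a \<bullet> b = 0"
    using unit_vector_orthogonal_to_few[of "{b}"] dim by (auto simp: inner_commute)
  define h where "h = 4 * diameter K + 1"
  have bd: "bounded K" using K(1) by (rule compact_imp_bounded)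
  have h: "0 < h" using diameter_ge_0[OF bd] by (simp add: h_def)
  have x: "x \<in> K" using xy K compact_imp_closed frontier_subset_closed by blast
  have flat: "\<bar>(z - x) \<bullet> v\<bar> \<le> h / 4" if "z \<in> K" "norm v = 1" for z v
  proof -
    have "\<bar>(z - x) \<bullet> v\<bar> \<le> norm (z - x)" using Cauchy_Schwarz_ineq2[of "z - x" v] that by simp
    also have "\<dots> \<le> diameter K" using diameter_bounded_bound[OF bd that(1) x] by (simp add: dist_norm)
    finally show ?thesis by (simp add: h_def)
  qed
  have "intrinsic_dist (frontier K) x y \<le> ennreal (L + 6 * h)"
    by (rule intrinsic_dist_le_if_flat[OF K xy e h a(1) b(1) a(2) b(2)]) (use flat a b in auto)
  then show ?thesis by (rule le_less_trans) simp
qed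

theorem proposition1p2:
  fixes n :: nat
  assumes "n \<ge> 1" and "DIM('a::euclidean_space) = n + 1"
  shows "\<exists>\<I> :: real \<Rightarrow> real.
           strict_mono_on {1<..} \<I> \<and> continuous_on {1<..} \<I> \<and>
           \<I> ` {1<..} \<subseteq> {0<..<unit_ball_vol (real n) / 2 ^ (n - 1)} \<and>
           (\<forall>(M :: 'a set) \<rho> x y.
              closed_convex_hypersurface M \<longrightarrow> \<rho> > 1 \<longrightarrow> x \<in> M \<longrightarrow> y \<in> M \<longrightarrow> x \<noteq> y \<longrightarrow>
              intrinsic_dist M x y / ennreal (norm (y - x)) \<ge> ennreal \<rho> \<longrightarrow>
              hausdorff_measure n M > ennreal (\<I> \<rho>) * intrinsic_dist M x y ^ n)"
proof -
  \<comment> \<open>The box size is \<open>h = (d - L) / 7\<close>, so that \<open>L + 6 * h < d\<close>, and the frame has \<open>\<eta> = h / 4\<close>; hence the factor \<open>28 = 7 * 4\<close>.\<close>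
  define c where "c = unit_ball_vol (real n) / 2 ^ n / 2 ^ (n * (n + 1)) / 28 ^ n"
  have \<omega>: "0 < unit_ball_vol (real n)" by (simp add: unit_ball_vol_pos)
  then have c: "0 < c" by (simp add: c_def)
  have c_le: "c \<le> unit_ball_vol (real n) / 2 ^ (n - 1)"
  proof -
    have "(2::real) ^ (n - 1) \<le> 2 ^ n" by (intro power_increasing) auto
    also have "\<dots> * 1 * 1 \<le> 2 ^ n * 2 ^ (n * (n + 1)) * 28 ^ n"
      by (intro mult_mono one_le_power) auto
    finally have "unit_ball_vol (real n) / (2 ^ n * 2 ^ (n * (n + 1)) * 28 ^ n) \<le> unit_ball_vol (real n) / 2 ^ (n - 1)"
      using \<omega> by (intro divide_left_mono) auto
    then show ?thesis by (simp add: c_def)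
  qed
  \<comment> \<open>Halving \<open>c\<close> makes the final inequality strict.\<close>
  define I where "I \<rho> = c / 2 * (1 - 1 / \<rho>) ^ n" for \<rho> :: real
  have "strict_mono_on {1<..} I"
  proof (rule strict_mono_onI)
    fix r s :: real assume "r \<in> {1<..}" "s \<in> {1<..}" "r < s"
    then have "(1 - 1 / r) ^ n < (1 - 1 / s) ^ n"
      using assms(1) by (intro power_strict_mono) (auto simp: field_simps)
    then show "I r < I s" using c by (simp add: I_def)
  qed
  moreover have "continuous_on {1<..} I"
    unfolding I_def by (intro continuous_intros) auto
  moreover have "I ` {1<..} \<subseteq> {0<..<unit_ball_vol (real n) / 2 ^ (n - 1)}"
  proof (rule image_subsetI)
    fix r :: real assume r: "r \<in> {1<..}"
    then have "0 < (1 - 1 / r) ^ n" "(1 - 1 / r) ^ n \<le> 1" by (auto intro!: power_le_one)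
    then have "0 < I r" "I r \<le> c / 2" using c by (auto simp: I_def)
    then show "I r \<in> {0<..<unit_ball_vol (real n) / 2 ^ (n - 1)}" using c c_le by auto
  qed
  moreover have "ennreal (I \<rho>) * intrinsic_dist M x y ^ n < hausdorff_measure n M"
    if M: "closed_convex_hypersurface M" and \<rho>: "1 < \<rho>" and xy: "x \<in> M" "y \<in> M" "x \<noteq> y"
      and ratio: "ennreal \<rho> \<le> intrinsic_dist M x y / ennreal (norm (y - x))"
    for M :: "'a set" and \<rho> x y
  proof -
    obtain K where K: "compact K" "convex K" "interior K \<noteq> {}" and MK: "M = frontier K"
      using M unfolding closed_convex_hypersurface_def by blast
    define L where "L = norm (y - x)"
    define e where "e = (1 / L) *\<^sub>R (y - x)"
    have L: "0 < L" using xy by (simp add: L_def)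
    have e: "norm e = 1" "0 < L" "y = x + L *\<^sub>R e"
      using L by (simp_all add: e_def) (simp add: L_def)
    note xyK = xy(1,2)[unfolded MK]
    have "intrinsic_dist M x y < top"
      unfolding MK using intrinsic_dist_finite[OF K xyK e] assms by simp
    then obtain d where d: "0 \<le> d" "intrinsic_dist M x y = ennreal d"
      by (metis less_top_ennreal)
    have "\<rho> \<le> d / L"
      using ratio d L \<rho> by (simp add: divide_ennreal flip: L_def)
    then have Ld: "\<rho> * L \<le> d" using L by (simp add: field_simps)
    have "L < \<rho> * L" using L \<rho> by simp
    with Ld L have d0: "0 < d" "L < d" by linarith+
    have Ld': "L \<le> d / \<rho>" using Ld \<rho> by (simp add: field_simps)
    define h where "h = (d - L) / 7"
    have h: "0 < h" using d0 by (simp add: h_def)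
    have "ennreal (L + 6 * h) < ennreal d"
      using d0 L by (intro ennreal_lessI) (auto simp: h_def field_simps)
    then have far: "ennreal (L + 6 * h) < intrinsic_dist (frontier K) x y" using d MK by simp
    have "n < DIM('a)" using assms by simp
    with triangular_frame_if_far[OF K xyK e h far]
    obtain p f where p: "\<And>i. i \<le> n \<Longrightarrow> p i \<in> K" and fr: "triangular_frame (h / 4) n p f" by blast
    have "ennreal (unit_ball_vol (real n) / 2 ^ n * ((h / 4) ^ n / 2 ^ (n * (n + 1)))) \<le> hausdorff_measure n M"
      unfolding MK by (rule hausdorff_measure_frontier_ge[OF K(1,2) fr _ p]) (use h assms in auto)
    also have "unit_ball_vol (real n) / 2 ^ n * ((h / 4) ^ n / 2 ^ (n * (n + 1))) = c * (d - L) ^ n"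
      by (simp add: c_def h_def power_divide field_simps flip: power_mult_distrib)
    finally have area: "ennreal (c * (d - L) ^ n) \<le> hausdorff_measure n M" .
    have "(1 - 1 / \<rho>) * d \<le> d - L" using Ld' by (simp add: algebra_simps)
    then have "((1 - 1 / \<rho>) * d) ^ n \<le> (d - L) ^ n"
      using \<rho> d0 by (intro power_mono) auto
    then have "c * ((1 - 1 / \<rho>) * d) ^ n \<le> c * (d - L) ^ n" using c by simp
    moreover have "0 < c * ((1 - 1 / \<rho>) * d) ^ n" using c \<rho> d0 by simp
    ultimately have "c / 2 * ((1 - 1 / \<rho>) * d) ^ n < c * (d - L) ^ n" by linarith
    then have "I \<rho> * d ^ n < c * (d - L) ^ n" by (simp add: I_def power_mult_distrib mult_ac)
    then have "ennreal (I \<rho> * d ^ n) < ennreal (c * (d - L) ^ n)"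
      using c d0 by (intro ennreal_lessI) auto
    also note area
    finally have "ennreal (I \<rho> * d ^ n) < hausdorff_measure n M" .
    moreover have "0 \<le> I \<rho>" using c \<rho> by (simp add: I_def)
    ultimately show ?thesis using d by (simp add: ennreal_mult ennreal_power)
  qed
  ultimately show ?thesis by blast
qed


end
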